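(* Let $N\ge 2$ be an integer and let $p(i),q(i)>0$ with $p(i)+q(i)\le 1$ for $i\in\{1,\ldots,N-1\}$ be the winning and losing probabilities of a gambler's ruin game on $\{0,1,\ldots,N\}$. Then for every $1\le i\le N$, $$EW_{0:i:N}=EW_{0:1:N}-EW_{0:1:i},$$ where, for every $1\le i\le N$, $$EW_{0:1:i}=\sum_{n=1}^{i-1}\frac{\rho_{0:n:i}}{p(n)}\sum_{s=0}^{\lfloor (i-1-n)/2\rfloor}\xi^{n+1,i-1}_s .$$ Moreover, for every $0\le i\le N-1$, $$EB_{0:i:N}=EW'_{0:N-i:N},$$ where $W'_{0:N-i:N}$ is the variable $W_{0:N-i:N}$ defined for the gambler's ruin game with rates $p'(s)=q(N-s)$ and $q'(s)=p(N-s)$, $s\in\{0,\ldots,N\}$.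
   Context: Set $p(0)=q(0)=p(N)=q(N)=0$. The gambler's ruin game is the Markov chain $(X_k)_{k\ge0}$ on $\{0,\ldots,N\}$ that moves from $i$ to $i+1$ with probability $p(i)$, from $i$ to $i-1$ with probability $q(i)$, and stays at $i$ with probability $1-p(i)-q(i)$. Put $r(i)=q(i)/p(i)$ for $1\le i\le N-1$. For $0\le j\le i\le k\le N$, $j<k$, consider the chain started at $X_0=i$ and stopped on reaching $j$ (losing) or $k$ (winning). $T_{j:i:k}$ is the first time $n\ge 0$ with $X_n\in\{j,k\}$; $\rho_{j:i:k}$ is the probability that the chain started at $i$ reaches $k$ before $j$; it is given by $$\rho_{j:i:k}=\frac{\sum_{n=j+1}^{i}\prod_{s=j+1}^{n-1}r(s)}{\sum_{n=j+1}^{k}\prod_{s=j+1}^{n-1}r(s)}.$$ $W_{j:i:k}$ is $T_{j:i:k}$ conditioned on $X_{T_{j:i:k}}=k$, and $B_{j:i:k}$ is $T_{j:i:k}$ conditioned on $X_{T_{j:i:k}}=j$. $E$ denotes expectation. For integers $n,m$ with $n\le m+1$ and $0\le k\le\lfloor (m-n+1)/2\rfloor$, let $\mathbf{j}^{n,m}_k$ be the collection of all $k$-element sets $\{j_1<\cdots<j_k\}$ of integers with $j_1\ge n+1$, $j_k\le m$ and $j_i\le j_{i+1}-2$ for $1\le i\le k-1$ (for $k=0$ it consists of the empty set only). For $\mathbf{j}\in\mathbf{j}^{n,m}_k$ put $\mathbf{j}-1=\{j_1-1,\ldots,j_k-1\}$, $$\delta^{n,m}_{\mathbf{j}}=(-1)^k\prod_{s\in\mathbf{j}}r(s)\prod_{s\in\{n,\ldots,m\}\setminus(\mathbf{j}\cup(\mathbf{j}-1))}(1+r(s)),\qquad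 \xi^{n,m}_k=\sum_{\mathbf{j}\in\mathbf{j}^{n,m}_k}\delta^{n,m}_{\mathbf{j}},$$ where $\{n,\ldots,m\}=\emptyset$ if $n>m$. Empty sums equal $0$ and empty products equal $1$. *)

theory Defs
  imports "HOL-Probability.Probability"
begin

definition gr_trans :: "(nat \<Rightarrow> real) \<Rightarrow> (nat \<Rightarrow> real) \<Rightarrow> nat \<Rightarrow> nat \<Rightarrow> real" where
  "gr_trans p q i j =
     (if j = i + 1 then p i
      else if i = j + 1 then q i
      else if j = i then 1 - p i - q i
      else 0)"

text \<open>The process \<open>X\<close> on the probability space \<open>M\<close> is the gambler's ruin Markov chain on
  \<open>{0..N}\<close> started at \<open>i\<close>.  The law of the process is determined by these
  conditions; the underlying probability space is left arbitrary.\<close>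

definition gamblers_ruin ::
  "nat \<Rightarrow> (nat \<Rightarrow> real) \<Rightarrow> (nat \<Rightarrow> real) \<Rightarrow> nat \<Rightarrow> 'a measure \<Rightarrow> (nat \<Rightarrow> 'a \<Rightarrow> nat) \<Rightarrow> bool" where
  "gamblers_ruin N p q i M X \<longleftrightarrow>
     prob_space M \<and>
     (\<forall>n. X n \<in> measurable M (count_space {0..N})) \<and>
     (AE \<omega> in M. X 0 \<omega> = i) \<and>
     (\<forall>n x. \<forall>y\<in>{0..N}. \<P>(\<omega> in M. \<forall>m\<le>n. X m \<omega> = x m) > 0 \<longrightarrow>
        \<P>(\<omega> in M. X (Suc n) \<omega> = y \<bar> \<forall>m\<le>n. X m \<omega> = x m) = gr_trans p q (x n) y)"

text \<open>The time \<open>T\<close> at which \<open>{j, k}\<close> is first reached; it is \<open>\<infinity>\<close> on paths that never reach it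
  (infimum of the empty set in \<^typ>\<open>enat\<close>).\<close>

definition stop_time :: "(nat \<Rightarrow> 'a \<Rightarrow> nat) \<Rightarrow> nat \<Rightarrow> nat \<Rightarrow> 'a \<Rightarrow> enat" where
  "stop_time X j k \<omega> = Inf {enat n |n. X n \<omega> \<in> {j, k}}"

text \<open>The event that \<open>T\<close> is finite and the chain is at \<open>e\<close> at time \<open>T\<close>.\<close>

definition stopped_at :: "'a measure \<Rightarrow> (nat \<Rightarrow> 'a \<Rightarrow> nat) \<Rightarrow> nat \<Rightarrow> nat \<Rightarrow> nat \<Rightarrow> 'a set" where
  "stopped_at M X j k e = {\<omega> \<in> space M. \<exists>n. stop_time X j k \<omega> = enat n \<and> X n \<omega> = e}"

text \<open>In the following, the starting point \<open>i\<close> of \<open>\<rho>\<^bsub>j:i:k\<^esub>\<close>, \<open>W\<^bsub>j:i:k\<^esub>\<close>, \<open>B\<^bsub>j:i:k\<^esub>\<close> is that of the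
  chain \<open>X\<close>.\<close>

definition rho :: "'a measure \<Rightarrow> (nat \<Rightarrow> 'a \<Rightarrow> nat) \<Rightarrow> nat \<Rightarrow> nat \<Rightarrow> real" where
  "rho M X j k = measure M (stopped_at M X j k k)"

text \<open>The expectations of \<open>T\<close> under the conditional measures given that the chain stops at \<open>k\<close>
  (winning) or at \<open>j\<close> (losing).  They are taken in the extended reals, so no integrability
  convention is involved: an equation with a real number asserts finiteness.\<close>

definition EW :: "'a measure \<Rightarrow> (nat \<Rightarrow> 'a \<Rightarrow> nat) \<Rightarrow> nat \<Rightarrow> nat \<Rightarrow> ereal" where
  "EW M X j k =
     enn2ereal (\<integral>\<^sup>+ \<omega>. ennreal_of_enat (stop_time X j k \<omega>) \<partial>uniform_measure M (stopped_at M X j k k))"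

definition EB :: "'a measure \<Rightarrow> (nat \<Rightarrow> 'a \<Rightarrow> nat) \<Rightarrow> nat \<Rightarrow> nat \<Rightarrow> ereal" where
  "EB M X j k =
     enn2ereal (\<integral>\<^sup>+ \<omega>. ennreal_of_enat (stop_time X j k \<omega>) \<partial>uniform_measure M (stopped_at M X j k j))"

text \<open>For a set, the condition \<open>j\<^sub>i \<le> j\<^sub>i\<^sub>+\<^sub>1 - 2\<close> on its increasing enumeration says that any two
  elements \<open>a < b\<close> satisfy \<open>a + 2 \<le> b\<close>.\<close>

definition jsets :: "nat \<Rightarrow> nat \<Rightarrow> nat \<Rightarrow> nat set set" where
  "jsets n m k =
     {J. J \<subseteq> {n+1..m} \<and> card J = k \<and> (\<forall>a\<in>J. \<forall>b\<in>J. a < b \<longrightarrow> a + 2 \<le> b)}"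

definition delta :: "(nat \<Rightarrow> real) \<Rightarrow> nat \<Rightarrow> nat \<Rightarrow> nat set \<Rightarrow> real" where
  "delta r n m J =
     (-1) ^ card J * (\<Prod>s\<in>J. r s) * (\<Prod>s\<in>{n..m} - (J \<union> (\<lambda>s. s - 1) ` J). 1 + r s)"

definition xi :: "(nat \<Rightarrow> real) \<Rightarrow> nat \<Rightarrow> nat \<Rightarrow> nat \<Rightarrow> real" where
  "xi r n m k = (\<Sum>J\<in>jsets n m k. delta r n m J)"

end

theory Submission
  imports Defs
begin

text \<open>Let \<open>h(i)\<close> and \<open>g(i)\<close> be the zeroth and first moments of the exit time on the event of
  winning at \<open>k\<close>, so that \<open>EW\<^bsub>0:i:k\<^esub> = g(i) / h(i)\<close>.  The function \<open>h\<close> is harmonic, and \<open>g\<close> solves the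
  same equation with source \<open>h\<close>.  Hence the Wronskian \<open>h(i+1) g(i) - h(i) g(i+1)\<close> obeys a first-order
  recursion, and \<open>g(i)/h(i) - g(i+1)/h(i+1)\<close> turns out not to depend on \<open>k\<close>.  Summing these
  differences gives the additivity, and summation by parts gives the explicit formula, because
  the alternating sum of the \<open>\<xi>\<close> is a continuant equal to \<open>\<Sum>\<^sub>j \<Prod>\<^sub>s r(s)\<close>.  The statement on losing holds
  since the law of the exit time and place is invariant under reflection of the state space.\<close>

section \<open>First exit time and its measurability\<close>

lemma stop_time_eq_enat_iff:
  "stop_time X j k \<omega> = enat n \<longleftrightarrow> X n \<omega> \<in> {j, k} \<and> (\<forall>m<n. X m \<omega> \<notin> {j, k})"
    (is "?T = _ \<longleftrightarrow> ?R n")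
proof -
  have T: "?T = enat n" if "?R n" for n
    unfolding stop_time_def
  proof (rule antisym)
    show "Inf {enat n |n. X n \<omega> \<in> {j, k}} \<le> enat n"
      using that by (intro Inf_lower) auto
    show "enat n \<le> Inf {enat n |n. X n \<omega> \<in> {j, k}}"
      using that by (intro Inf_greatest) (auto simp: not_less[symmetric])
  qed
  have "?R n" if eq: "?T = enat n"
  proof -
    have "\<exists>n. X n \<omega> \<in> {j, k}"
    proof (rule ccontr)
      assume "\<not> ?thesis"
      then have "{enat n |n. X n \<omega> \<in> {j, k}} = {}" by blast
      then have "?T = \<infinity>" by (simp only: stop_time_def) (simp add: top_enat_def)
      then show False using eq by simp
    qed
    then have "?R (LEAST n. X n \<omega> \<in> {j, k})"
      by (metis (mono_tags, lifting) LeastI not_less_Least)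
    then show "?R n" using T eq by (metis enat.inject)
  qed
  then show ?thesis using T by blast
qed

lemma stopped_at_eq:
  "e \<in> {j, k} \<Longrightarrow> stopped_at M X j k e =
     (\<Union>n. {\<omega> \<in> space M. (\<forall>m<n. X m \<omega> \<notin> {j, k}) \<and> X n \<omega> = e})"
  by (auto simp: stopped_at_def stop_time_eq_enat_iff)

lemma stop_time_measurable:
  assumes "\<And>n. X n \<in> measurable M (count_space UNIV)"
  shows "stop_time X j k \<in> measurable M (count_space UNIV)"
proof (rule measurable_count_space_eq_countable[THEN iffD2], safe)
  note [measurable] = assms
  have fin: "stop_time X j k -` {enat n} \<inter> space M \<in> sets M" for n
  proof -
    have "stop_time X j k -` {enat n} \<inter> space M =
        {\<omega> \<in> space M. (X n \<omega> = j \<or> X n \<omega> = k) \<and> (\<forall>m<n. X m \<omega> \<noteq> j \<and> X m \<omega> \<noteq> k)}"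
      using stop_time_eq_enat_iff[of X j k _ n] by auto
    also have "\<dots> \<in> sets M" by measurable
    finally show ?thesis .
  qed
  fix t :: enat
  show "stop_time X j k -` {t} \<inter> space M \<in> sets M"
  proof (cases t)
    case (enat n)
    then show ?thesis using fin by simp
  next
    case infinity
    have "stop_time X j k -` {\<infinity>} \<inter> space M =
        space M - (\<Union>n. stop_time X j k -` {enat n} \<inter> space M)"
      by (auto simp del: not_infinity_eq)
    also have "\<dots> \<in> sets M" using fin by (intro sets.Diff sets.countable_UN) auto
    finally show ?thesis using infinity by simp
  qed
qed auto

section \<open>Path probabilities and the law of exit time and place\<close>

lemma gamblers_ruin_measurable:
  assumes "gamblers_ruin N p q i M X"
  shows "X n \<in> measurable M (count_space UNIV)"
proof -
  have "X n \<in> measurable M (count_space {0..N})"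
    using assms by (simp add: gamblers_ruin_def)
  then show ?thesis
    using measurable_compose[of "X n" M "count_space {0..N}" "\<lambda>x. x" "count_space UNIV"] by simp
qed

lemma gamblers_ruin_le:
  "gamblers_ruin N p q i M X \<Longrightarrow> \<omega> \<in> space M \<Longrightarrow> X n \<omega> \<le> N"
  using measurable_space[of "X n" M "count_space {0..N}" \<omega>] by (auto simp: gamblers_ruin_def)

text \<open>The product form also covers histories of probability zero, where both sides vanish;
  sums may then run over all histories.\<close>

lemma gamblers_ruin_cylinder:
  assumes ruin: "gamblers_ruin N p q i M X" and "y \<le> N"
  shows "\<P>(\<omega> in M. (\<forall>m\<le>n. X m \<omega> = x m) \<and> X (Suc n) \<omega> = y) =
         \<P>(\<omega> in M. \<forall>m\<le>n. X m \<omega> = x m) * gr_trans p q (x n) y"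
proof -
  interpret prob_space M using ruin by (simp add: gamblers_ruin_def)
  note [measurable] = gamblers_ruin_measurable[OF ruin]
  let ?C = "\<P>(\<omega> in M. \<forall>m\<le>n. X m \<omega> = x m)"
  show ?thesis
  proof (cases "?C > 0")
    case True
    then have "\<P>(\<omega> in M. X (Suc n) \<omega> = y \<bar> \<forall>m\<le>n. X m \<omega> = x m) = gr_trans p q (x n) y"
      using ruin \<open>y \<le> N\<close> unfolding gamblers_ruin_def by auto
    then have "\<P>(\<omega> in M. X (Suc n) \<omega> = y \<and> (\<forall>m\<le>n. X m \<omega> = x m)) = ?C * gr_trans p q (x n) y"
      using True by (simp add: cond_prob_def field_simps)
    then show ?thesis by (simp add: conj_commute)
  next
    case False
    then have "?C = 0" by (simp add: not_less measure_le_0_iff)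
    moreover have "\<P>(\<omega> in M. (\<forall>m\<le>n. X m \<omega> = x m) \<and> X (Suc n) \<omega> = y) \<le> ?C"
      by (intro finite_measure_mono) auto
    ultimately show ?thesis by (simp add: measure_le_0_iff)
  qed
qed

text \<open>The chain is defined by conditioning on complete histories. Those that avoid
  \<open>S\<close> before time \<open>n\<close> and end in \<open>x\<close> are finitely many and
  share one transition factor, so summing over them gives the claim.\<close>

lemma gamblers_ruin_markov:
  assumes ruin: "gamblers_ruin N p q i M X" and "x \<le> N" "y \<le> N"
  shows "\<P>(\<omega> in M. (\<forall>m<n. X m \<omega> \<notin> S) \<and> X n \<omega> = x \<and> X (Suc n) \<omega> = y) =
         \<P>(\<omega> in M. (\<forall>m<n. X m \<omega> \<notin> S) \<and> X n \<omega> = x) * gr_trans p q x y"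
proof -
  interpret prob_space M using ruin by (simp add: gamblers_ruin_def)
  note [measurable] = gamblers_ruin_measurable[OF ruin]
  \<comment> \<open>Extensional functions are equal once they agree on \<open>{..n}\<close>, which
    makes the cylinder events of different histories disjoint.\<close>
  define H where "H = {h \<in> {..n} \<rightarrow>\<^sub>E {..N}. (\<forall>m<n. h m \<notin> S) \<and> h n = x}"
  have "finite H" unfolding H_def by (simp add: finite_PiE)
  have split: "\<P>(\<omega> in M. ((\<forall>m<n. X m \<omega> \<notin> S) \<and> X n \<omega> = x) \<and> P \<omega>) =
      (\<Sum>h\<in>H. \<P>(\<omega> in M. (\<forall>m\<le>n. X m \<omega> = h m) \<and> P \<omega>))"
    if [measurable]: "Measurable.pred M P" for P
  proof -
    have "{\<omega> \<in> space M. ((\<forall>m<n. X m \<omega> \<notin> S) \<and> X n \<omega> = x) \<and> P \<omega>} =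
        (\<Union>h\<in>H. {\<omega> \<in> space M. (\<forall>m\<le>n. X m \<omega> = h m) \<and> P \<omega>})"
    proof (safe, goal_cases)
      case (1 \<omega>)
      then have "restrict (\<lambda>m. X m \<omega>) {..n} \<in> H"
        using gamblers_ruin_le[OF ruin] by (auto simp: H_def)
      then show ?case using 1 by (intro UN_I[of "restrict (\<lambda>m. X m \<omega>) {..n}"]) auto
    qed (auto simp: H_def)
    also have "prob \<dots> = (\<Sum>h\<in>H. \<P>(\<omega> in M. (\<forall>m\<le>n. X m \<omega> = h m) \<and> P \<omega>))"
    proof (rule finite_measure_finite_Union[OF \<open>finite H\<close>])
      show "disjoint_family_on (\<lambda>h. {\<omega> \<in> space M. (\<forall>m\<le>n. X m \<omega> = h m) \<and> P \<omega>}) H"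
      proof (rule disjoint_family_on_def[THEN iffD2], intro ballI impI, rule ccontr)
        fix h h' assume h: "h \<in> H" "h' \<in> H" "h \<noteq> h'"
          and "{\<omega> \<in> space M. (\<forall>m\<le>n. X m \<omega> = h m) \<and> P \<omega>} \<inter>
               {\<omega> \<in> space M. (\<forall>m\<le>n. X m \<omega> = h' m) \<and> P \<omega>} \<noteq> {}"
        then have "\<forall>m\<in>{..n}. h m = h' m" by force
        then have "h = h'" using h by (intro PiE_ext[of h "{..n}" "\<lambda>_. {..N}"]) (auto simp: H_def)
        then show False using h by simp
      qed
    qed auto
    finally show ?thesis .
  qed
  have "\<P>(\<omega> in M. (\<forall>m<n. X m \<omega> \<notin> S) \<and> X n \<omega> = x \<and> X (Suc n) \<omega> = y) =
      (\<Sum>h\<in>H. \<P>(\<omega> in M. (\<forall>m\<le>n. X m \<omega> = h m) \<and> X (Suc n) \<omega> = y))"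
    using split[of "\<lambda>\<omega>. X (Suc n) \<omega> = y"] by (simp add: conj_assoc)
  also have "\<dots> = (\<Sum>h\<in>H. \<P>(\<omega> in M. \<forall>m\<le>n. X m \<omega> = h m) * gr_trans p q x y)"
    using gamblers_ruin_cylinder[OF ruin \<open>y \<le> N\<close>] by (intro sum.cong) (auto simp: H_def)
  also have "\<dots> = \<P>(\<omega> in M. (\<forall>m<n. X m \<omega> \<notin> S) \<and> X n \<omega> = x) * gr_trans p q x y"
    using split[of "\<lambda>_. True"] by (simp add: sum_distrib_right)
  finally show ?thesis .
qed

text \<open>For \<open>e \<in> S\<close>, the probability that the chain started at \<open>y\<close> enters \<open>S\<close> for the first time at
  time \<open>n\<close> and does so at \<open>e\<close>, by first-step analysis.\<close>

fun hit :: "(nat \<Rightarrow> real) \<Rightarrow> (nat \<Rightarrow> real) \<Rightarrow> nat set \<Rightarrow> nat \<Rightarrow> nat \<Rightarrow> nat \<Rightarrow> real" where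
  "hit p q S e 0 y = (if y = e then 1 else 0)"
| "hit p q S e (Suc n) y = (if y \<in> S then 0 else
     p y * hit p q S e n (y + 1) + q y * hit p q S e n (y - 1) + (1 - p y - q y) * hit p q S e n y)"

text \<open>\<open>0 < y\<close> makes \<open>y - 1\<close> a true predecessor. From
  \<open>y = N\<close> the upward move would leave the state space; \<open>p N = 0\<close> removes
  it.\<close>

lemma sum_gr_trans:
  assumes "0 < y" "y \<le> N" "p N = 0"
  shows "(\<Sum>z\<le>N. gr_trans p q y z * f z) = p y * f (y + 1) + q y * f (y - 1) + (1 - p y - q y) * f y"
proof -
  have "(\<Sum>z\<le>N. gr_trans p q y z * f z) = (\<Sum>z\<le>N. (if z = y + 1 then p y * f z else 0) +
      (if z = y - 1 then q y * f z else 0) + (if z = y then (1 - p y - q y) * f z else 0))"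
    using assms by (intro sum.cong) (auto simp: gr_trans_def)
  also have "\<dots> = (if y + 1 \<le> N then p y * f (y + 1) else 0) + q y * f (y - 1) + (1 - p y - q y) * f y"
    using assms by (simp add: sum.distrib)
  also have "(if y + 1 \<le> N then p y * f (y + 1) else 0) = p y * f (y + 1)"
    using assms by (cases "y = N") auto
  finally show ?thesis .
qed

lemma prob_first_exit:
  assumes ruin: "gamblers_ruin N p q i M X" and "p N = 0" and "0 \<in> S" and "e \<le> N"
  shows "\<P>(\<omega> in M. (\<forall>m<n. X m \<omega> \<notin> S) \<and> X n \<omega> = e) = hit p q S e n i"
proof -
  interpret prob_space M using ruin by (simp add: gamblers_ruin_def)
  note [measurable] = gamblers_ruin_measurable[OF ruin]
  \<comment> \<open>The forward masses \<open>a m\<close> paired with the backward quantities \<open>hit n\<close> give a value depending only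
    on \<open>m + n\<close>; this avoids restarting the chain at other points, for which no Markov property
    relating the different \<open>M\<close> is available.\<close>
  define a where "a n y = \<P>(\<omega> in M. (\<forall>m<n. X m \<omega> \<notin> S) \<and> X n \<omega> = y)" for n y
  have start: "AE \<omega> in M. X 0 \<omega> = i" using ruin by (simp add: gamblers_ruin_def)
  have "i \<le> N"
  proof -
    have "\<P>(\<omega> in M. X 0 \<omega> = i) = 1" using start by (simp add: prob_Collect_eq_1)
    then have "{\<omega> \<in> space M. X 0 \<omega> = i} \<noteq> {}" by (metis measure_empty zero_neq_one)
    then obtain \<omega> where "\<omega> \<in> space M" "X 0 \<omega> = i" by auto
    then show ?thesis using gamblers_ruin_le[OF ruin, of \<omega> 0] by simp
  qed
  have a0: "a 0 y = (if y = i then 1 else 0)" for y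
  proof (cases "y = i")
    case True
    then show ?thesis using start by (simp add: a_def prob_Collect_eq_1)
  next
    case False
    then have "AE \<omega> in M. X 0 \<omega> \<noteq> y" using start by auto
    then show ?thesis using False by (simp add: a_def prob_Collect_eq_0)
  qed
  have a_Suc: "a (Suc n) y = (\<Sum>x\<in>{..N} - S. a n x * gr_trans p q x y)" if "y \<le> N" for n y
  proof -
    have "{\<omega> \<in> space M. (\<forall>m<Suc n. X m \<omega> \<notin> S) \<and> X (Suc n) \<omega> = y} =
        (\<Union>x\<in>{..N} - S. {\<omega> \<in> space M. (\<forall>m<n. X m \<omega> \<notin> S) \<and> X n \<omega> = x \<and> X (Suc n) \<omega> = y})"
      using gamblers_ruin_le[OF ruin] by (auto simp: less_Suc_eq)
    then have "a (Suc n) y = prob \<dots>" by (simp add: a_def)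
    also have "\<dots> = (\<Sum>x\<in>{..N} - S.
        \<P>(\<omega> in M. (\<forall>m<n. X m \<omega> \<notin> S) \<and> X n \<omega> = x \<and> X (Suc n) \<omega> = y))"
      by (rule finite_measure_finite_Union) (auto simp: disjoint_family_on_def)
    also have "\<dots> = (\<Sum>x\<in>{..N} - S. a n x * gr_trans p q x y)"
      using gamblers_ruin_markov[OF ruin _ that] by (intro sum.cong) (auto simp: a_def)
    finally show ?thesis .
  qed
  have step: "(\<Sum>y\<le>N. a (Suc m) y * hit p q S e n y) = (\<Sum>y\<le>N. a m y * hit p q S e (Suc n) y)" for m n
  proof -
    have "(\<Sum>y\<le>N. a (Suc m) y * hit p q S e n y) =
        (\<Sum>y\<le>N. \<Sum>x\<in>{..N} - S. a m x * gr_trans p q x y * hit p q S e n y)"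
      by (simp add: a_Suc sum_distrib_right)
    also have "\<dots> = (\<Sum>x\<in>{..N} - S. a m x * (\<Sum>y\<le>N. gr_trans p q x y * hit p q S e n y))"
      by (subst sum.swap) (simp add: sum_distrib_left mult.assoc)
    also have "\<dots> = (\<Sum>x\<in>{..N} - S. a m x * hit p q S e (Suc n) x)"
    proof (intro sum.cong refl)
      fix x assume x: "x \<in> {..N} - S"
      then have "0 < x" using \<open>0 \<in> S\<close> by (metis DiffD2 gr0I)
      then show "a m x * (\<Sum>y\<le>N. gr_trans p q x y * hit p q S e n y) = a m x * hit p q S e (Suc n) x"
        using x assms(2) by (subst sum_gr_trans) auto
    qed
    \<comment> \<open>States in \<open>S\<close> may be added back: from them \<open>hit\<close> is
      zero at positive times.\<close>
    also have "\<dots> = (\<Sum>y\<le>N. a m y * hit p q S e (Suc n) y)"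
      by (intro sum.mono_neutral_left) auto
    finally show ?thesis .
  qed
  have shift: "(\<Sum>y\<le>N. a m y * hit p q S e n y) = (\<Sum>y\<le>N. a 0 y * hit p q S e (m + n) y)" for m n
  proof (induction m arbitrary: n)
    case (Suc m)
    show ?case using step[of m n] Suc[of "Suc n"] by simp
  qed simp
  have "a n e = (\<Sum>y\<le>N. a n y * hit p q S e 0 y)"
    using \<open>e \<le> N\<close> by (simp add: if_distrib[of "(*) _"] cong: if_cong)
  also have "\<dots> = (\<Sum>y\<le>N. a 0 y * hit p q S e n y)"
    using shift[of n 0] by simp
  also have "\<dots> = hit p q S e n i"
    using \<open>i \<le> N\<close> by (simp add: a0 if_distrib[of "\<lambda>x. x * _"] cong: if_cong)
  finally show ?thesis by (simp add: a_def)
qed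

text \<open>As \<open>e\<close> lies in \<open>{j, k}\<close>, the first-exit events for different
  times are disjoint, and countable additivity applies.\<close>

lemma emeasure_stopped_at:
  assumes ruin: "gamblers_ruin N p q i M X" and "p N = 0" and "0 \<in> {j, k}" "e \<in> {j, k}" "e \<le> N"
  shows "emeasure M (stopped_at M X j k e) = (\<Sum>n. ennreal (hit p q {j, k} e n i))"
proof -
  interpret prob_space M using ruin by (simp add: gamblers_ruin_def)
  note [measurable] = gamblers_ruin_measurable[OF ruin]
  let ?E = "\<lambda>n. {\<omega> \<in> space M. (\<forall>m<n. X m \<omega> \<notin> {j, k}) \<and> X n \<omega> = e}"
  have "disjoint_family ?E"
    using \<open>e \<in> {j, k}\<close> unfolding disjoint_family_on_def
    by (auto dest!: linorder_cases) (metis linorder_cases)+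
  then have "emeasure M (\<Union>n. ?E n) = (\<Sum>n. emeasure M (?E n))"
    by (subst suminf_emeasure) auto
  then show ?thesis
    using prob_first_exit[OF ruin assms(2,3,5)]
    by (simp add: stopped_at_eq[OF assms(4)] emeasure_eq_measure)
qed

text \<open>The stopping time equals \<open>n\<close> on the \<open>n\<close>-th of the disjoint
  first-exit events, so its integral is a series; conditioning divides by the mass of the
  event.\<close>

lemma nn_integral_stop_time:
  assumes ruin: "gamblers_ruin N p q i M X" and "p N = 0" and "0 \<in> {j, k}" "e \<in> {j, k}" "e \<le> N"
  shows "(\<integral>\<^sup>+ \<omega>. ennreal_of_enat (stop_time X j k \<omega>) \<partial>uniform_measure M (stopped_at M X j k e)) =
    (\<Sum>n. of_nat n * ennreal (hit p q {j, k} e n i)) / (\<Sum>n. ennreal (hit p q {j, k} e n i))"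
proof -
  interpret prob_space M using ruin by (simp add: gamblers_ruin_def)
  note [measurable] = gamblers_ruin_measurable[OF ruin]
  let ?E = "\<lambda>n. {\<omega> \<in> space M. (\<forall>m<n. X m \<omega> \<notin> {j, k}) \<and> X n \<omega> = e}"
  have [measurable]: "stop_time X j k \<in> measurable M (count_space UNIV)"
    by (rule stop_time_measurable) simp
  have T: "stop_time X j k \<omega> = enat n" if "\<omega> \<in> ?E n" for \<omega> n
    using that \<open>e \<in> {j, k}\<close> by (auto simp: stop_time_eq_enat_iff)
  have [measurable]: "stopped_at M X j k e \<in> sets M"
    by (simp add: stopped_at_eq[OF assms(4)])
  have integrand: "ennreal_of_enat (stop_time X j k \<omega>) * indicator (stopped_at M X j k e) \<omega> =
      (\<Sum>n. of_nat n * indicator (?E n) \<omega>)" for \<omega>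
  proof (cases "\<omega> \<in> stopped_at M X j k e")
    case True
    then obtain l where l: "\<omega> \<in> ?E l" unfolding stopped_at_eq[OF assms(4)] by blast
    have "\<omega> \<notin> ?E n" if "n \<noteq> l" for n using T[OF l] T[of \<omega> n] that by auto
    then have "(\<lambda>n. of_nat n * indicator (?E n) \<omega>) = (\<lambda>n. if n = l then of_nat n else 0 :: ennreal)"
      using l by (intro ext) (simp add: indicator_def)
    then have "(\<Sum>n. of_nat n * indicator (?E n) \<omega>) = (of_nat l :: ennreal)"
      using sums_unique[OF sums_single[of l "of_nat :: nat \<Rightarrow> ennreal"]] by simp
    then show ?thesis using True by (simp only: T[OF l] ennreal_of_enat_enat) simp
  next
    case False
    then have "\<omega> \<notin> ?E n" for n unfolding stopped_at_eq[OF assms(4)] by blast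
    then have "indicator (?E n) \<omega> = (0 :: ennreal)" for n by (meson indicator_simps(2))
    then show ?thesis using False by simp
  qed
  have "(\<integral>\<^sup>+ \<omega>. ennreal_of_enat (stop_time X j k \<omega>) * indicator (stopped_at M X j k e) \<omega> \<partial>M) =
      (\<Sum>n. of_nat n * emeasure M (?E n))"
    by (simp only: integrand) (simp add: nn_integral_suminf nn_integral_cmult)
  also have "\<dots> = (\<Sum>n. of_nat n * ennreal (hit p q {j, k} e n i))"
    using prob_first_exit[OF ruin assms(2,3,5)] by (simp add: emeasure_eq_measure)
  finally show ?thesis
    using emeasure_stopped_at[OF assms] by (simp add: nn_integral_uniform_measure)
qed

section \<open>Difference equations for winning probability and first moment\<close>

definition rprod :: "(nat \<Rightarrow> real) \<Rightarrow> nat \<Rightarrow> real" where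
  "rprod r n = (\<Prod>s\<in>{1..n}. r s)"

text \<open>The scale function of the chain for \<open>r = q / p\<close>; harmonic functions
  vanishing at 0 are its multiples.\<close>

definition rsum :: "(nat \<Rightarrow> real) \<Rightarrow> nat \<Rightarrow> real" where
  "rsum r n = (\<Sum>l<n. rprod r l)"

lemma rprod_0 [simp]: "rprod r 0 = 1"
  by (simp add: rprod_def)

lemma rprod_Suc [simp]: "rprod r (Suc n) = rprod r n * r (Suc n)"
  by (simp add: rprod_def)

lemma rsum_0 [simp]: "rsum r 0 = 0"
  by (simp add: rsum_def)

lemma rsum_Suc [simp]: "rsum r (Suc n) = rsum r n + rprod r n"
  by (simp add: rsum_def)

text \<open>Up to sign, the increments of a function on which the generator of the chain equals -1
  in the interior. Starting from 0 keeps the slopes nonnegative.\<close>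

fun exit_slope :: "(nat \<Rightarrow> real) \<Rightarrow> (nat \<Rightarrow> real) \<Rightarrow> nat \<Rightarrow> real" where
  "exit_slope p q 0 = 0"
| "exit_slope p q (Suc i) = q (Suc i) / p (Suc i) * exit_slope p q i + 1 / p (Suc i)"

text \<open>Rates are constrained strictly between 0 and the target \<open>k\<close> only, so the
  locale serves the target \<open>N\<close> as well as smaller targets of the same game.\<close>

locale exit_chain =
  fixes p q :: "nat \<Rightarrow> real" and k :: nat
  assumes k_pos: "0 < k"
    and rates: "\<And>i. 0 < i \<Longrightarrow> i < k \<Longrightarrow> p i > 0 \<and> q i > 0 \<and> p i + q i \<le> 1"
begin

abbreviation win :: "nat \<Rightarrow> nat \<Rightarrow> real" where
  "win n i \<equiv> hit p q {0, k} k n i"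

definition win_prob :: "nat \<Rightarrow> real" where "win_prob i = (\<Sum>n. win n i)"

definition win_moment :: "nat \<Rightarrow> real" where "win_moment i = (\<Sum>n. real n * win n i)"

abbreviation r :: "nat \<Rightarrow> real" where "r s \<equiv> q s / p s"

lemma win_at_0 [simp]: "win n 0 = 0"
  using k_pos by (cases n) auto

lemma win_at_k [simp]: "win n k = (if n = 0 then 1 else 0)"
  by (cases n) auto

lemma boundary_cases:
  assumes "i \<le> k"
  obtains "i = 0" | "i = k" | "0 < i" "i < k"
  using assms by linarith

lemma win_nonneg: "i \<le> k \<Longrightarrow> 0 \<le> win n i"
proof (induction n arbitrary: i)
  case (Suc n)
  show ?case
  proof (cases rule: boundary_cases[OF Suc.prems])
    case 3
    then have "0 \<le> win n (i + 1)" "0 \<le> win n (i - 1)" "0 \<le> win n i"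
      using Suc.IH by auto
    then show ?thesis using 3 rates[of i] by (simp add: add_nonneg_nonneg)
  qed auto
qed simp

lemma sum_win_Suc:
  assumes "0 < i" "i < k"
  shows "(\<Sum>n<m. c n * win (Suc n) i) = p i * (\<Sum>n<m. c n * win n (i + 1)) +
     q i * (\<Sum>n<m. c n * win n (i - 1)) + (1 - p i - q i) * (\<Sum>n<m. c n * win n i)"
  using assms by (simp add: sum_distrib_left sum.distrib[symmetric] algebra_simps)

lemma convex_le:
  assumes "0 < i" "i < k" "a \<le> a'" "b \<le> b'" "c \<le> c'"
  shows "p i * a + q i * b + (1 - p i - q i) * c \<le> p i * a' + q i * b' + (1 - p i - q i) * c'"
  using rates[OF assms(1,2)] assms(3-5) by (intro add_mono mult_left_mono) auto

text \<open>Induction on the truncation: a partial sum at an interior point is a convex combination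
  of shorter ones, so the bound 1 persists. Summability follows.\<close>

lemma sum_win_le: "i \<le> k \<Longrightarrow> (\<Sum>n<m. win n i) \<le> 1"
proof (induction m arbitrary: i)
  case (Suc m)
  have split: "(\<Sum>n<Suc m. win n i) = win 0 i + (\<Sum>n<m. win (Suc n) i)"
    by (rule sum.lessThan_Suc_shift)
  show ?case
  proof (cases rule: boundary_cases[OF Suc.prems])
    case 3
    have "(\<Sum>n<Suc m. win n i) = p i * (\<Sum>n<m. win n (i + 1)) +
        q i * (\<Sum>n<m. win n (i - 1)) + (1 - p i - q i) * (\<Sum>n<m. win n i)"
      using split sum_win_Suc[OF 3, of "\<lambda>_. 1" m] 3 by simp
    also have "\<dots> \<le> p i * 1 + q i * 1 + (1 - p i - q i) * 1"
      using 3 by (intro convex_le Suc.IH) auto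
    finally show ?thesis by simp
  qed (simp_all add: split)
qed simp

lemma exit_slope_nonneg: "i < k \<Longrightarrow> 0 \<le> exit_slope p q i"
proof (induction i)
  case (Suc i)
  then show ?case using rates[of "Suc i"] by auto
qed simp

text \<open>The sums of slopes form a supersolution of the equation for the expected exit time,
  which bounds the first moment uniformly in the truncation.\<close>

lemma sum_moment_le: "i \<le> k \<Longrightarrow> (\<Sum>n<m. real n * win n i) \<le> (\<Sum>j\<in>{i..<k}. exit_slope p q j)"
proof (induction m arbitrary: i)
  case 0
  then show ?case using exit_slope_nonneg by (auto intro!: sum_nonneg)
next
  case (Suc m)
  let ?u = "\<lambda>i. \<Sum>j\<in>{i..<k}. exit_slope p q j"
  have split: "(\<Sum>n<Suc m. real n * win n i) = (\<Sum>n<m. real (Suc n) * win (Suc n) i)"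
    by (subst sum.lessThan_Suc_shift) simp
  show ?case
  proof (cases rule: boundary_cases[OF Suc.prems])
    case 1
    then show ?thesis using exit_slope_nonneg by (auto simp del: hit.simps intro!: sum_nonneg)
  next
    case 2
    then have "(\<Sum>n<Suc m. real n * win n i) = 0" by (intro sum.neutral) simp
    then show ?thesis using 2 by simp
  next
    case 3
    have u1: "?u i = exit_slope p q i + ?u (i + 1)"
      using 3 by (simp add: sum.atLeast_Suc_lessThan)
    have u2: "?u (i - 1) = exit_slope p q (i - 1) + ?u i"
      using 3 by (simp add: sum.atLeast_Suc_lessThan)
    have e: "p i * exit_slope p q i = q i * exit_slope p q (i - 1) + 1"
      using 3 rates[of i] by (cases i) (auto simp: field_simps)
    \<comment> \<open>The weight \<open>n + 1\<close> splits into \<open>n\<close>, handled by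
      induction, and 1, which leaves a mass of at most 1.\<close>
    have "(\<Sum>n<Suc m. real n * win n i) =
        (\<Sum>n<m. real n * win (Suc n) i) + (\<Sum>n<m. win (Suc n) i)"
      unfolding split by (simp del: hit.simps add: sum.distrib[symmetric] algebra_simps)
    also have "(\<Sum>n<m. win (Suc n) i) \<le> 1"
      using sum_win_le[of i "Suc m"] 3 unfolding sum.lessThan_Suc_shift by simp
    also have "(\<Sum>n<m. real n * win (Suc n) i) \<le>
        p i * ?u (i + 1) + q i * ?u (i - 1) + (1 - p i - q i) * ?u i"
      unfolding sum_win_Suc[OF 3] using 3 by (intro convex_le Suc.IH) auto
    \<comment> \<open>Averaging lowers \<open>?u\<close> by exactly 1, which absorbs that
      mass.\<close>
    also have "p i * ?u (i + 1) + q i * ?u (i - 1) + (1 - p i - q i) * ?u i + 1 = ?u i"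
      unfolding u2 using e by (simp add: u1 algebra_simps)
    finally show ?thesis by simp
  qed
qed

lemma summable_win: "i \<le> k \<Longrightarrow> summable (\<lambda>n. win n i)"
  by (rule summableI_nonneg_bounded[of _ 1]) (auto simp: win_nonneg sum_win_le)

lemma summable_moment: "i \<le> k \<Longrightarrow> summable (\<lambda>n. real n * win n i)"
  by (rule summableI_nonneg_bounded[OF _ sum_moment_le]) (auto simp: win_nonneg)

lemma win_boundary [simp]: "win_prob 0 = 0" "win_prob k = 1" "win_moment 0 = 0" "win_moment k = 0"
proof -
  have "(\<lambda>n. win n k) = (\<lambda>n. if n = 0 then 1 else 0)" by auto
  then show "win_prob k = 1" using sums_unique[OF sums_single[of 0 "\<lambda>_. 1::real"]] by (simp add: win_prob_def)
  have "(\<lambda>n. real n * win n k) = (\<lambda>_. 0)" by auto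
  then show "win_moment k = 0" by (simp add: win_moment_def)
qed (simp_all add: win_prob_def win_moment_def)

text \<open>First-step analysis summed over all times. The shift of the time index loses nothing, as
  \<open>win 0 i = 0\<close> for \<open>i\<close> different from \<open>k\<close>.\<close>

lemma win_prob_step:
  assumes i: "0 < i" "i < k"
  shows "p i * win_prob (i + 1) + q i * win_prob (i - 1) = (p i + q i) * win_prob i"
proof -
  have "(\<lambda>n. p i * win n (i + 1) + q i * win n (i - 1) + (1 - p i - q i) * win n i) sums
      (p i * win_prob (i + 1) + q i * win_prob (i - 1) + (1 - p i - q i) * win_prob i)"
    unfolding win_prob_def using i by (intro sums_add sums_mult summable_sums summable_win) auto
  then have "(\<lambda>n. win (Suc n) i) sums
      (p i * win_prob (i + 1) + q i * win_prob (i - 1) + (1 - p i - q i) * win_prob i)"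
    using i by simp
  moreover have "(\<lambda>n. win (Suc n) i) sums win_prob i"
    using summable_sums[OF summable_win[of i]] i
    by (subst sums_Suc_iff) (simp add: win_prob_def del: hit.simps(2))
  ultimately have "p i * win_prob (i + 1) + q i * win_prob (i - 1) + (1 - p i - q i) * win_prob i = win_prob i"
    by (rule sums_unique2)
  then show ?thesis by (simp add: algebra_simps)
qed

text \<open>After one step the weight is \<open>n + 1\<close>; its part 1 contributes the winning
  probability as a source.\<close>

lemma win_moment_step:
  assumes i: "0 < i" "i < k"
  shows "p i * win_moment (i + 1) + q i * win_moment (i - 1) = (p i + q i) * win_moment i - win_prob i"
proof -
  have "(\<lambda>n. p i * (real n * win n (i + 1)) + q i * (real n * win n (i - 1)) +
        (1 - p i - q i) * (real n * win n i)) sums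
      (p i * win_moment (i + 1) + q i * win_moment (i - 1) + (1 - p i - q i) * win_moment i)"
    unfolding win_moment_def using i by (intro sums_add sums_mult summable_sums summable_moment) auto
  then have 1: "(\<lambda>n. real n * win (Suc n) i) sums
      (p i * win_moment (i + 1) + q i * win_moment (i - 1) + (1 - p i - q i) * win_moment i)"
    using i by (simp add: algebra_simps)
  have 2: "(\<lambda>n. win (Suc n) i) sums win_prob i"
    using summable_sums[OF summable_win[of i]] i
    by (subst sums_Suc_iff) (simp add: win_prob_def del: hit.simps(2))
  have "(\<lambda>n. real (Suc n) * win (Suc n) i) sums
      (p i * win_moment (i + 1) + q i * win_moment (i - 1) + (1 - p i - q i) * win_moment i + win_prob i)"
    using sums_add[OF 1 2] by (simp add: algebra_simps del: hit.simps(2))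
  moreover have "(\<lambda>n. real (Suc n) * win (Suc n) i) sums win_moment i"
    using summable_sums[OF summable_moment[of i]] i
    by (subst sums_Suc_iff[of "\<lambda>n. real n * win n i"]) (simp add: win_moment_def del: hit.simps(2))
  ultimately have "p i * win_moment (i + 1) + q i * win_moment (i - 1) + (1 - p i - q i) * win_moment i +
      win_prob i = win_moment i"
    by (rule sums_unique2)
  then show ?thesis by (simp add: algebra_simps)
qed

lemma rprod_pos: "n < k \<Longrightarrow> 0 < rprod r n"
  unfolding rprod_def using rates by (intro prod_pos) auto

lemma rsum_pos: "0 < n \<Longrightarrow> n \<le> k \<Longrightarrow> 0 < rsum r n"
  unfolding rsum_def using rprod_pos by (intro sum_pos) auto

lemma win_prob_diff: "i < k \<Longrightarrow> win_prob (Suc i) - win_prob i = rprod r i * win_prob 1"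
proof (induction i)
  case (Suc i)
  have "p (Suc i) * (win_prob (Suc (Suc i)) - win_prob (Suc i)) = q (Suc i) * (win_prob (Suc i) - win_prob i)"
    using win_prob_step[of "Suc i"] Suc.prems by (simp add: algebra_simps)
  then have "win_prob (Suc (Suc i)) - win_prob (Suc i) = r (Suc i) * (win_prob (Suc i) - win_prob i)"
    using rates[of "Suc i"] Suc.prems by (simp add: field_simps)
  then show ?case using Suc by simp
qed simp

text \<open>The increments are proportional to \<open>rprod r\<close>, and the value 1 at
  \<open>k\<close> fixes the factor.\<close>

lemma win_prob_eq: "i \<le> k \<Longrightarrow> win_prob i = rsum r i / rsum r k"
proof -
  have mult: "win_prob i = rsum r i * win_prob 1" if "i \<le> k" for i
    using that
  proof (induction i)
    case (Suc i)
    then show ?case using win_prob_diff[of i] by (simp add: algebra_simps)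
  qed simp
  show "win_prob i = rsum r i / rsum r k" if "i \<le> k"
    using mult[OF that] mult[of k] rsum_pos[of k] k_pos by (simp add: field_simps)
qed

lemma win_prob_pos: "0 < i \<Longrightarrow> i \<le> k \<Longrightarrow> 0 < win_prob i"
  using rsum_pos k_pos by (simp add: win_prob_eq)

section \<open>The Wronskian and the ratio of moment to probability\<close>

text \<open>The source \<open>(win_prob n)^2 / p n\<close> of the Wronskian recursion, divided by
  the integrating factor \<open>rprod r n\<close> and freed of \<open>1 / (rsum r k)^2\<close>. It
  does not involve \<open>k\<close>, so chains with different targets share it.\<close>

definition wronski :: "nat \<Rightarrow> real" where "wronski n = (rsum r n)\<^sup>2 / (p n * rprod r n)"

text \<open>Cross-multiplying the two difference equations cancels the terms with
  \<open>p + q\<close>. What remains is a first-order recursion with ratio \<open>r\<close> and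
  source \<open>(win_prob i)^2 / p i\<close>, starting from 0.\<close>

lemma wronskian:
  "i < k \<Longrightarrow> win_prob (Suc i) * win_moment i - win_prob i * win_moment (Suc i) =
     rprod r i * (\<Sum>n=1..i. wronski n) / (rsum r k)\<^sup>2"
proof (induction i)
  case (Suc i)
  let ?j = "Suc i"
  have j: "0 < ?j" "?j < k" using Suc.prems by auto
  have pos: "p ?j > 0" "rprod r ?j > 0" using rates[OF j] rprod_pos[OF j(2)] by auto
  have "p ?j * (win_prob (Suc ?j) * win_moment ?j - win_prob ?j * win_moment (Suc ?j)) -
      q ?j * (win_prob ?j * win_moment i - win_prob i * win_moment ?j) =
      win_moment ?j * (p ?j * win_prob (Suc ?j) + q ?j * win_prob i) -
      win_prob ?j * (p ?j * win_moment (Suc ?j) + q ?j * win_moment i)"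
    by (simp add: algebra_simps)
  also have "\<dots> = (win_prob ?j)\<^sup>2"
  proof -
    have eqs: "p ?j * win_prob (Suc ?j) + q ?j * win_prob i = (p ?j + q ?j) * win_prob ?j"
      "p ?j * win_moment (Suc ?j) + q ?j * win_moment i = (p ?j + q ?j) * win_moment ?j - win_prob ?j"
      using win_prob_step[OF j] win_moment_step[OF j] by simp_all
    show ?thesis unfolding eqs by (simp add: algebra_simps power2_eq_square)
  qed
  finally have "win_prob (Suc ?j) * win_moment ?j - win_prob ?j * win_moment (Suc ?j) =
      r ?j * (win_prob ?j * win_moment i - win_prob i * win_moment ?j) + (win_prob ?j)\<^sup>2 / p ?j"
    using pos by (simp add: field_simps)
  also have "win_prob ?j * win_moment i - win_prob i * win_moment ?j =
      rprod r i * (\<Sum>n=1..i. wronski n) / (rsum r k)\<^sup>2"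
    using Suc by simp
  also have "(win_prob ?j)\<^sup>2 / p ?j = rprod r ?j * wronski ?j / (rsum r k)\<^sup>2"
    using pos j by (simp add: wronski_def win_prob_eq power_divide del: rprod_Suc rsum_Suc)
  also have "r ?j * (rprod r i * (\<Sum>n=1..i. wronski n) / (rsum r k)\<^sup>2) + rprod r ?j * wronski ?j / (rsum r k)\<^sup>2 =
      rprod r ?j * (\<Sum>n=1..?j. wronski n) / (rsum r k)\<^sup>2"
    by (simp add: add_divide_distrib distrib_left mult_ac)
  finally show ?case .
qed simp

text \<open>Dividing the Wronskian by two winning probabilities cancels \<open>(rsum r k)^2\<close>,
  so the target drops out; additivity rests on this. As \<open>rprod r i\<close> is an increment of
  \<open>rsum r\<close>, reciprocals appear.\<close>

lemma ratio_diff: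
  assumes i: "0 < i" "i < k"
  shows "win_moment i / win_prob i - win_moment (Suc i) / win_prob (Suc i) =
     (\<Sum>n=1..i. wronski n) * (1 / rsum r i - 1 / rsum r (Suc i))"
proof -
  have pos: "win_prob i > 0" "win_prob (Suc i) > 0" "rsum r i > 0" "rsum r (Suc i) > 0" "rsum r k > 0"
    using i win_prob_pos[of i] win_prob_pos[of "Suc i"] rsum_pos[of i] rsum_pos[of "Suc i"] rsum_pos[of k] by auto
  have "win_moment i / win_prob i - win_moment (Suc i) / win_prob (Suc i) =
      (win_prob (Suc i) * win_moment i - win_prob i * win_moment (Suc i)) / (win_prob i * win_prob (Suc i))"
    using pos by (simp add: field_simps)
  also have "\<dots> = rprod r i * (\<Sum>n=1..i. wronski n) / (rsum r k)\<^sup>2 / (win_prob i * win_prob (Suc i))"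
    using wronskian i by simp
  also have "\<dots> = rprod r i * (\<Sum>n=1..i. wronski n) / (rsum r i * rsum r (Suc i))"
    using i pos by (simp add: win_prob_eq power2_eq_square del: rsum_Suc)
  also have "rprod r i = rsum r (Suc i) - rsum r i" by simp
  also have "(rsum r (Suc i) - rsum r i) * (\<Sum>n=1..i. wronski n) / (rsum r i * rsum r (Suc i)) =
      (\<Sum>n=1..i. wronski n) * (1 / rsum r i - 1 / rsum r (Suc i))"
    using pos(3,4) by (simp add: field_simps del: rsum_Suc)
  finally show ?thesis .
qed

lemma ratio_eq:
  assumes "0 < i" "i \<le> k"
  shows "win_moment i / win_prob i = (\<Sum>j\<in>{i..<k}. (\<Sum>n=1..j. wronski n) * (1 / rsum r j - 1 / rsum r (Suc j)))"
proof -
  have "(\<Sum>j\<in>{i..<k}. (\<Sum>n=1..j. wronski n) * (1 / rsum r j - 1 / rsum r (Suc j))) =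
      (\<Sum>j\<in>{i..<k}. win_moment j / win_prob j - win_moment (Suc j) / win_prob (Suc j))"
    using assms by (intro sum.cong) (auto simp: ratio_diff simp del: rsum_Suc)
  also have "\<dots> = win_moment i / win_prob i - win_moment k / win_prob k"
    using sum_Suc_diff'[of i k "\<lambda>j. - (win_moment j / win_prob j)"] assms by simp
  finally show ?thesis by simp
qed

lemma abel_sum:
  "0 < j \<Longrightarrow> (\<Sum>i\<in>{1..<j}. (\<Sum>n=1..i. wronski n) * (1 / rsum r i - 1 / rsum r (Suc i))) =
     (\<Sum>n\<in>{1..<j}. wronski n * (1 / rsum r n - 1 / rsum r j))"
proof (induction j)
  case (Suc j)
  let ?d = "1 / rsum r j - 1 / rsum r (Suc j)"
  show ?case
  proof (cases "j = 0")
    case False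
    have "(\<Sum>n\<in>{1..<Suc j}. wronski n * (1 / rsum r n - 1 / rsum r (Suc j))) =
        (\<Sum>n\<in>{1..<Suc j}. wronski n * (1 / rsum r n - 1 / rsum r j) + wronski n * ?d)"
      by (intro sum.cong) (auto simp: algebra_simps)
    also have "\<dots> = (\<Sum>n\<in>{1..<Suc j}. wronski n * (1 / rsum r n - 1 / rsum r j)) + (\<Sum>n\<in>{1..<Suc j}. wronski n) * ?d"
      by (simp only: sum.distrib sum_distrib_right)
    also have "(\<Sum>n\<in>{1..<Suc j}. wronski n * (1 / rsum r n - 1 / rsum r j)) =
        (\<Sum>n\<in>{1..<j}. wronski n * (1 / rsum r n - 1 / rsum r j))"
      using False by (simp add: sum.atLeastLessThan_Suc)
    also have "(\<Sum>n\<in>{1..<Suc j}. wronski n) = (\<Sum>n=1..j. wronski n)"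
      by (simp only: atLeastLessThanSuc_atLeastAtMost)
    finally show ?thesis using Suc False by (simp del: rsum_Suc)
  qed simp
qed simp

lemma ratio_1_eq:
  "win_moment 1 / win_prob 1 = (\<Sum>n\<in>{1..<k}. win_prob n / p n * ((rsum r k - rsum r n) / rprod r n))"
proof -
  have "win_moment 1 / win_prob 1 = (\<Sum>n\<in>{1..<k}. wronski n * (1 / rsum r n - 1 / rsum r k))"
    using ratio_eq[of 1] abel_sum[of k] k_pos by simp
  also have "\<dots> = (\<Sum>n\<in>{1..<k}. win_prob n / p n * ((rsum r k - rsum r n) / rprod r n))"
  proof (intro sum.cong refl)
    fix n assume n: "n \<in> {1..<k}"
    then have "rsum r n > 0" "rsum r k > 0" "rprod r n > 0" "p n > 0"
      using rsum_pos[of n] rsum_pos[of k] rprod_pos[of n] rates[of n] by auto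
    moreover have "win_prob n = rsum r n / rsum r k" using n by (intro win_prob_eq) auto
    ultimately show "wronski n * (1 / rsum r n - 1 / rsum r k) =
        win_prob n / p n * ((rsum r k - rsum r n) / rprod r n)"
      by (simp add: wronski_def power2_eq_square divide_simps)
  qed
  finally show ?thesis .
qed

end

section \<open>Separated sets and the continuant\<close>

text \<open>All sizes are taken together, since the recursion in \<open>m\<close> mixes them; the
  sets of one size form \<open>jsets\<close>.\<close>

definition sep_sets :: "nat \<Rightarrow> nat \<Rightarrow> nat set set" where
  "sep_sets n m = {J. J \<subseteq> {n+1..m} \<and> (\<forall>a\<in>J. \<forall>b\<in>J. a < b \<longrightarrow> a + 2 \<le> b)}"

lemma finite_sep_sets [simp]: "finite (sep_sets n m)"
  by (rule finite_subset[of _ "Pow {n+1..m}"]) (auto simp: sep_sets_def)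

text \<open>\<open>J\<close> and \<open>J - 1\<close> are disjoint, equally large and contained in
  \<open>{n..m}\<close>. Hence the range of \<open>s\<close> in the formula reaches every separated
  set.\<close>

lemma card_sep_set:
  assumes "J \<in> sep_sets n m"
  shows "card J \<le> (m + 1 - n) div 2"
proof -
  let ?J' = "(\<lambda>s. s - 1) ` J"
  have J: "J \<subseteq> {n+1..m}" "\<And>a b. a \<in> J \<Longrightarrow> b \<in> J \<Longrightarrow> a < b \<Longrightarrow> a + 2 \<le> b"
    using assms by (auto simp: sep_sets_def)
  have fin: "finite J" using J(1) finite_subset by blast
  have "inj_on (\<lambda>s. s - 1) J" using J(1) by (intro inj_on_diff_nat) force
  then have "card ?J' = card J" by (rule card_image)
  moreover have "J \<inter> ?J' = {}" using J by force
  moreover have "card (J \<union> ?J') \<le> card {n..m}"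
    using J(1) by (intro card_mono) force+
  ultimately show ?thesis using fin by (simp add: card_Un_disjoint)
qed

lemma sum_xi_eq:
  "(\<Sum>s=0..(m + 1 - n) div 2. xi r n m s) = (\<Sum>J\<in>sep_sets n m. delta r n m J)"
proof -
  have "jsets n m s = {J \<in> sep_sets n m. card J = s}" for s
    by (auto simp: jsets_def sep_sets_def)
  then show ?thesis
    unfolding xi_def using card_sep_set by (simp add: sum.group image_subset_iff)
qed

text \<open>A set with top element \<open>m + 2\<close> cannot contain \<open>m + 1\<close>, so the
  rest of it lies below.\<close>

lemma sep_sets_rec:
  assumes "n \<le> m + 1"
  shows "sep_sets n (m + 2) = sep_sets n (m + 1) \<union> insert (m + 2) ` sep_sets n m"
proof (intro equalityI subsetI)
  fix J assume J: "J \<in> sep_sets n (m + 2)"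
  show "J \<in> sep_sets n (m + 1) \<union> insert (m + 2) ` sep_sets n m"
  proof (cases "m + 2 \<in> J")
    case True
    have "J - {m + 2} \<subseteq> {n+1..m}"
    proof
      fix a assume "a \<in> J - {m + 2}"
      then have "n + 1 \<le> a" "a \<le> m + 2" "a \<in> J" "a \<noteq> m + 2"
        using J by (auto simp: sep_sets_def)
      moreover from this have "a + 2 \<le> m + 2"
        using J True unfolding sep_sets_def by (metis (mono_tags, lifting) le_neq_implies_less mem_Collect_eq)
      ultimately show "a \<in> {n+1..m}" by simp
    qed
    then have "J - {m + 2} \<in> sep_sets n m" using J by (auto simp: sep_sets_def)
    then show ?thesis using True by (metis UnI2 image_eqI insert_Diff)
  next
    case False
    have "J \<subseteq> {n+1..m+1}"
    proof
      fix a assume "a \<in> J"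
      then have "a \<in> {n+1..m+2}" "a \<noteq> m + 2" using J False by (auto simp: sep_sets_def)
      then show "a \<in> {n+1..m+1}" by simp
    qed
    then show ?thesis using J by (auto simp: sep_sets_def)
  qed
next
  fix J assume "J \<in> sep_sets n (m + 1) \<union> insert (m + 2) ` sep_sets n m"
  then consider "J \<in> sep_sets n (m + 1)" | I where "J = insert (m + 2) I" "I \<in> sep_sets n m"
    by blast
  then show "J \<in> sep_sets n (m + 2)"
  proof cases
    case 1
    have "{n+1..m+1} \<subseteq> {n+1..m+2}" by auto
    with 1 show ?thesis unfolding sep_sets_def by blast
  next
    case 2
    then have "I \<subseteq> {n+1..m}" by (simp add: sep_sets_def)
    then have "J \<subseteq> {n+1..m+2}" "\<And>a. a \<in> I \<Longrightarrow> a \<le> m"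
      using 2(1) assms by auto
    moreover have "a + 2 \<le> b" if ab: "a \<in> J" "b \<in> J" "a < b" for a b
    proof -
      have "a \<in> I" using ab 2(1) calculation(2)[of b] by auto
      then show ?thesis using ab 2 calculation(2)[of a] by (auto simp: sep_sets_def)
    qed
    ultimately show ?thesis by (simp add: sep_sets_def)
  qed
qed

lemma delta_extend:
  assumes "n \<le> m + 1" "J \<in> sep_sets n m"
  shows "delta r n (m + 1) J = (1 + r (m + 1)) * delta r n m J"
proof -
  have "J \<subseteq> {n+1..m}" using assms by (auto simp: sep_sets_def)
  then have "{n..m + 1} - (J \<union> (\<lambda>s. s - 1) ` J) =
      insert (m + 1) ({n..m} - (J \<union> (\<lambda>s. s - 1) ` J))"
    using assms(1) by force
  then show ?thesis by (simp add: delta_def)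
qed

text \<open>The new element takes \<open>m + 1\<close> and \<open>m + 2\<close> out of the
  complement, so the second product is unchanged, while the first gains a factor and the sign
  flips.\<close>

lemma delta_insert:
  assumes "n \<le> m + 1" "J \<in> sep_sets n m"
  shows "delta r n (m + 2) (insert (m + 2) J) = - r (m + 2) * delta r n m J"
proof -
  have J: "J \<subseteq> {n+1..m}" using assms by (auto simp: sep_sets_def)
  then have "finite J" using finite_subset by blast
  moreover have "m + 2 \<notin> J" using J by auto
  moreover have "{n..m + 2} - (insert (m + 2) J \<union> (\<lambda>s. s - 1) ` insert (m + 2) J) =
      {n..m} - (J \<union> (\<lambda>s. s - 1) ` J)"
  proof -
    have "m + 1 \<notin> J" using J by auto
    have "{n..m + 2} - {m + 1, m + 2} = {n..m}" by auto
    moreover have "insert (m + 2) J \<union> (\<lambda>s. s - 1) ` insert (m + 2) J =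
        {m + 1, m + 2} \<union> (J \<union> (\<lambda>s. s - 1) ` J)" by auto
    ultimately show ?thesis by (simp only: Diff_Int_distrib Un_assoc[symmetric]) blast
  qed
  ultimately show ?thesis by (simp add: delta_def)
qed

lemma sum_delta_rec:
  assumes "n \<le> m + 1"
  shows "(\<Sum>J\<in>sep_sets n (m + 2). delta r n (m + 2) J) =
    (1 + r (m + 2)) * (\<Sum>J\<in>sep_sets n (m + 1). delta r n (m + 1) J) -
    r (m + 2) * (\<Sum>J\<in>sep_sets n m. delta r n m J)"
proof -
  have notin: "m + 2 \<notin> J" if "J \<in> sep_sets n (m + 1) \<union> sep_sets n m" for J
    using that by (auto simp: sep_sets_def)
  have inj: "inj_on (insert (m + 2)) (sep_sets n m)"
    using notin by (intro inj_onI) (metis UnCI insert_ident)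
  have "(\<Sum>J\<in>sep_sets n (m + 2). delta r n (m + 2) J) =
      (\<Sum>J\<in>sep_sets n (m + 1). delta r n (m + 2) J) +
      (\<Sum>J\<in>insert (m + 2) ` sep_sets n m. delta r n (m + 2) J)"
    unfolding sep_sets_rec[OF assms] using notin by (intro sum.union_disjoint) auto
  also have "(\<Sum>J\<in>sep_sets n (m + 1). delta r n (m + 2) J) =
      (1 + r (m + 2)) * (\<Sum>J\<in>sep_sets n (m + 1). delta r n (m + 1) J)"
    unfolding sum_distrib_left using delta_extend[of n "m + 1" _ r] assms
    by (intro sum.cong) auto
  also have "(\<Sum>J\<in>insert (m + 2) ` sep_sets n m. delta r n (m + 2) J) =
      - r (m + 2) * (\<Sum>J\<in>sep_sets n m. delta r n m J)"
    unfolding sum.reindex[OF inj] sum_distrib_left using delta_insert[OF assms]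
    by (intro sum.cong) auto
  finally show ?thesis by simp
qed

text \<open>The recursion of \<open>sum_delta_rec\<close> is that of a continuant, which is solved by differences of
  partial sums of \<^term>\<open>rprod r\<close>.\<close>

lemma sum_delta_eq:
  "rprod r n * (\<Sum>J\<in>sep_sets (Suc n) (n + d). delta r (Suc n) (n + d) J) =
     rsum r (Suc (n + d)) - rsum r n"
proof (induction d rule: induct_nat_012)
  case 0
  \<comment> \<open>Elements of separated sets exceed \<open>Suc n\<close>, so both base cases admit
    the empty set alone; the sums are 1 and \<open>1 + r (Suc n)\<close>.\<close>
  have "sep_sets (Suc n) n = {{}}" by (auto simp: sep_sets_def)
  then show ?case by (simp add: delta_def)
next
  case 1
  have "sep_sets (Suc n) (Suc n) = {{}}" by (auto simp: sep_sets_def)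
  then show ?case by (simp add: delta_def distrib_left)
next
  case (ge2 d)
  let ?T = "\<lambda>d. \<Sum>J\<in>sep_sets (Suc n) (n + d). delta r (Suc n) (n + d) J"
  have "?T (Suc (Suc d)) = (1 + r (n + d + 2)) * ?T (Suc d) - r (n + d + 2) * ?T d"
    using sum_delta_rec[of "Suc n" "n + d" r] by simp
  then have "rprod r n * ?T (Suc (Suc d)) = (1 + r (n + d + 2)) * (rprod r n * ?T (Suc d)) -
      r (n + d + 2) * (rprod r n * ?T d)"
    by (simp only: right_diff_distrib mult.left_commute)
  \<comment> \<open>By induction the two scaled sums differ by \<open>rprod r (n + d + 1)\<close>;
    times \<open>r (n + d + 2)\<close> this is the next term of \<open>rsum r\<close>.\<close>
  also have "\<dots> = rsum r (Suc (n + Suc (Suc d))) - rsum r n"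
    unfolding ge2.IH by (simp add: algebra_simps)
  finally show ?case .
qed

lemma sum_xi_closed_form:
  assumes "n < i" "rprod r n \<noteq> 0"
  shows "(\<Sum>s=0..(i - 1 - n) div 2. xi r (n + 1) (i - 1) s) = (rsum r i - rsum r n) / rprod r n"
proof -
  have "i - 1 - n = (i - 1) + 1 - (n + 1)" "n + (i - 1 - n) = i - 1" "Suc (n + (i - 1 - n)) = i"
    using assms(1) by auto
  then show ?thesis
    using sum_delta_eq[of r n "i - 1 - n"] sum_xi_eq[where m = "i - 1" and n = "n + 1" and r = r] assms(2)
    by (simp add: field_simps)
qed

section \<open>Conditional expectations as ratios of series\<close>

context exit_chain
begin

lemma suminf_ennreal_win:
  assumes "i \<le> k"
  shows "(\<Sum>n. ennreal (win n i)) = ennreal (win_prob i)"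
  unfolding win_prob_def using assms by (intro suminf_ennreal2 win_nonneg summable_win)

lemma rho_eq:
  assumes "gamblers_ruin N p q i M X" "p N = 0" "k \<le> N" "i \<le> k"
  shows "rho M X 0 k = win_prob i"
proof -
  have "0 \<le> win_prob i" unfolding win_prob_def using assms by (intro suminf_nonneg summable_win win_nonneg)
  moreover have "emeasure M (stopped_at M X 0 k k) = ennreal (win_prob i)"
    using emeasure_stopped_at[OF assms(1,2), of 0 k k] suminf_ennreal_win[OF assms(4)] assms(3) by simp
  ultimately show ?thesis by (simp add: rho_def measure_def)
qed

text \<open>For \<open>0 < i\<close> the winning probability is positive, so the extended quotient
  is a real one and the expectation is finite.\<close>

lemma EW_eq:
  assumes "gamblers_ruin N p q i M X" "p N = 0" "k \<le> N" "0 < i" "i \<le> k"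
  shows "EW M X 0 k = ereal (win_moment i / win_prob i)"
proof -
  have "0 \<le> win_moment i"
    unfolding win_moment_def using assms by (intro suminf_nonneg summable_moment mult_nonneg_nonneg win_nonneg) auto
  moreover have "(\<Sum>n. of_nat n * ennreal (win n i)) = ennreal (win_moment i)"
  proof -
    have "(\<Sum>n. of_nat n * ennreal (win n i)) = (\<Sum>n. ennreal (real n * win n i))"
      by (simp add: ennreal_mult' ennreal_of_nat_eq_real_of_nat)
    also have "\<dots> = ennreal (win_moment i)"
      unfolding win_moment_def using assms
      by (intro suminf_ennreal2 mult_nonneg_nonneg win_nonneg summable_moment) auto
    finally show ?thesis .
  qed
  ultimately show ?thesis
    using nn_integral_stop_time[OF assms(1,2), of 0 k k] suminf_ennreal_win[OF assms(5)]
      assms(3) win_prob_pos[OF assms(4,5)]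
    by (simp add: EW_def divide_ennreal)
qed

end

section \<open>Reflection of the state space and conclusion\<close>

text \<open>Reflection swaps upward and downward moves and the two boundary points, so the
  recursions agree in the interior; at the boundary both sides vanish at positive times.\<close>

lemma hit_reflect:
  assumes "y \<le> N"
  shows "hit p q {0, N} 0 n y = hit (\<lambda>s. q (N - s)) (\<lambda>s. p (N - s)) {0, N} N n (N - y)"
  using assms
proof (induction n arbitrary: y)
  case 0
  then show ?case by auto
next
  case (Suc n)
  show ?case
  proof (cases "0 < y \<and> y < N")
    case True
    then have "N - y + 1 = N - (y - 1)" "N - y - 1 = N - (y + 1)" "N - (N - y) = y"
      "N - y \<noteq> 0" "N - y \<noteq> N" by auto
    then show ?thesis
      using True Suc.IH[of "y + 1"] Suc.IH[of "y - 1"] Suc.IH[of y] by (simp add: algebra_simps)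
  next
    case False
    then have "y = 0 \<or> y = N" using Suc.prems by auto
    then show ?thesis by auto
  qed
qed

theorem theorem2p3:
  fixes N :: nat and p q :: "nat \<Rightarrow> real"
    and M :: "nat \<Rightarrow> 'a measure" and X :: "nat \<Rightarrow> nat \<Rightarrow> 'a \<Rightarrow> nat"
    and M' :: "nat \<Rightarrow> 'b measure" and X' :: "nat \<Rightarrow> nat \<Rightarrow> 'b \<Rightarrow> nat"
  assumes "N \<ge> 2"
    and "p 0 = 0" "q 0 = 0" "p N = 0" "q N = 0"
    and "\<And>i. i \<in> {1..N-1} \<Longrightarrow> p i > 0 \<and> q i > 0 \<and> p i + q i \<le> 1"
    and "\<And>i. i \<in> {0..N} \<Longrightarrow> gamblers_ruin N p q i (M i) (X i)"
    and "\<And>i. i \<in> {0..N} \<Longrightarrow> gamblers_ruin N (\<lambda>s. q (N - s)) (\<lambda>s. p (N - s)) i (M' i) (X' i)"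
  shows "(\<forall>i\<in>{1..N}. EW (M i) (X i) 0 N = EW (M 1) (X 1) 0 N - EW (M 1) (X 1) 0 i) \<and>
    (\<forall>i\<in>{1..N}. EW (M 1) (X 1) 0 i =
       ereal (\<Sum>n=1..i-1. rho (M n) (X n) 0 i / p n *
                (\<Sum>s=0..(i - 1 - n) div 2. xi (\<lambda>s. q s / p s) (n + 1) (i - 1) s))) \<and>
    (\<forall>i\<in>{0..N-1}. EB (M i) (X i) 0 N = EW (M' (N - i)) (X' (N - i)) 0 N)"
proof -
  have chain: "exit_chain p q k" if "0 < k" "k \<le> N" for k
    using assms(6) that by unfold_locales auto
  have "EW (M i) (X i) 0 N = EW (M 1) (X 1) 0 N - EW (M 1) (X 1) 0 i" if i: "i \<in> {1..N}" for i
  proof -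
    interpret n: exit_chain p q N using chain[of N] i by simp
    interpret i: exit_chain p q i using chain[of i] i by simp
    \<comment> \<open>Both ratios from 1 sum the same terms, over \<open>{1..<N}\<close> and
      \<open>{1..<i}\<close>; the remaining range \<open>{i..<N}\<close> gives the ratio from
      \<open>i\<close>.\<close>
    have "n.win_moment 1 / n.win_prob 1 = i.win_moment 1 / i.win_prob 1 + n.win_moment i / n.win_prob i"
      using i n.ratio_eq[of 1] n.ratio_eq[of i] i.ratio_eq[of 1]
      by (simp add: sum.atLeastLessThan_concat del: rsum_Suc)
    then show ?thesis
      using n.EW_eq[OF assms(7)[of i] assms(4)] n.EW_eq[OF assms(7)[of 1] assms(4)]
        i.EW_eq[OF assms(7)[of 1] assms(4)] i by simp
  qed
  moreover have "EW (M 1) (X 1) 0 i =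
       ereal (\<Sum>n=1..i-1. rho (M n) (X n) 0 i / p n *
                (\<Sum>s=0..(i - 1 - n) div 2. xi (\<lambda>s. q s / p s) (n + 1) (i - 1) s))"
    if i: "i \<in> {1..N}" for i
  proof -
    interpret exit_chain p q i using chain[of i] i by simp
    have "EW (M 1) (X 1) 0 i = ereal (win_moment 1 / win_prob 1)"
      using EW_eq[OF assms(7)[of 1] assms(4)] i by simp
    also have "win_moment 1 / win_prob 1 = (\<Sum>n=1..i-1. win_prob n / p n * ((rsum r i - rsum r n) / rprod r n))"
      unfolding ratio_1_eq using i by (intro sum.cong) auto
    also have "\<dots> = (\<Sum>n=1..i-1. rho (M n) (X n) 0 i / p n *
                (\<Sum>s=0..(i - 1 - n) div 2. xi r (n + 1) (i - 1) s))"
    proof (intro sum.cong refl)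
      fix n assume n: "n \<in> {1..i-1}"
      then have "n < i" by auto
      then have "rprod r n \<noteq> 0" using rprod_pos by (metis less_irrefl)
      moreover have "rho (M n) (X n) 0 i = win_prob n"
        using rho_eq[OF assms(7)[of n] assms(4)] n i \<open>n < i\<close> by simp
      ultimately show "win_prob n / p n * ((rsum r i - rsum r n) / rprod r n) =
          rho (M n) (X n) 0 i / p n * (\<Sum>s=0..(i - 1 - n) div 2. xi r (n + 1) (i - 1) s)"
        using sum_xi_closed_form[OF \<open>n < i\<close>, of r] by simp
    qed
    finally show ?thesis .
  qed
  moreover have "EB (M i) (X i) 0 N = EW (M' (N - i)) (X' (N - i)) 0 N" if i: "i \<in> {0..N-1}" for i
  proof -
    have le: "i \<le> N" using i by simp
    \<comment> \<open>Losing at 0 becomes winning at \<open>N\<close> in the reflected game, whose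
      upward rate at \<open>N\<close> is \<open>q 0 = 0\<close>. The integral formula thus applies
      to both games, and the series agree term by term.\<close>
    then show ?thesis
      using nn_integral_stop_time[OF assms(7)[of i] assms(4), of 0 N 0]
        nn_integral_stop_time[OF assms(8)[of "N - i"], of 0 N N] assms(3)
      by (simp add: EB_def EW_def hit_reflect[OF le])
  qed
  ultimately show ?thesis by blast
qed

end
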